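(* Let $\mathbb F_q$ be a finite field with $q$ elements, let $r\ge1$, let $\square,\tilde\square\subseteq\mathbb R^r$ be integral convex polytopes with Minkowski sum $\square+\tilde\square$, and let $U=\square\cap\mathbb Z^r$, $\tilde U=\tilde\square\cap\mathbb Z^r$, $T(\mathbb F_q)=(\mathbb F_q^* )^r$, $n=|T(\mathbb F_q)|$. Let $t$ be a non-negative integer and assume (i) $|\tilde U|>t$; (ii) $d(C_{\square+\tilde\square})>t$; (iii) $d(C_{\tilde\square})>n-d(C_\square)$. Let $y(P)=f(P)+e(P)$ for $P\in T(\mathbb F_q)$, where $f\in\mathbb F_q[U]$ and $e:T(\mathbb F_q)\to\mathbb F_q$ has support $T\subseteq T(\mathbb F_q)$ with $|T|\le t$. Let $(g,h)\in\mathbb F_q[\tilde U]\oplus\mathbb F_q[U+\tilde U]$ be in the kernel of the linear map $$\mathbb F_q[\tilde U]\oplus\mathbb F_q[U+\tilde U]\to\mathbb F_q^n,\qquad (g,h)\mapsto\bigl(g(P)y(P)-h(P)\bigr)_{P\in T(\mathbb F_q)}.$$ Then $g|_T=0$ and $h=g\cdot f$ as functions on $T(\mathbb F_q)$.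
   Context: For a finite set $W\subseteq\mathbb Z^r$, $\mathbb F_q[W]$ is the $\mathbb F_q$-linear span of the monomials $X_1^{w_1}\cdots X_r^{w_r}$, $w\in W$, in $\mathbb F_q[X_1^{\pm1},\dots,X_r^{\pm1}]$. $U+\tilde U=\{u+\tilde u: u\in U,\tilde u\in\tilde U\}$. For an integral convex polytope $\square\subseteq\mathbb R^r$, the toric code $C_\square$ is the image of the evaluation map $\mathbb F_q[\square\cap\mathbb Z^r]\to\mathbb F_q^{n}$, $f\mapsto(f(P))_{P\in T(\mathbb F_q)}$, and $d(C)$ denotes the minimum distance (minimal Hamming weight of a non-zero codeword) of a linear code $C$. The support of $e$ is the set of $P$ with $e(P)\ne0$. *)

theory Defs
  imports "HOL-Analysis.Analysis" "HOL-Library.Poly_Mapping"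
begin

text \<open>
  The Laurent polynomial ring in variables indexed by a finite type is the group ring of the
  exponent lattice: multiplication of \<^typ>\<open>(int ^ 'r) \<Rightarrow>\<^sub>0 'a\<close> is convolution, and
  \<open>Poly_Mapping.single w 1\<close> is the monomial with exponent vector \<open>w\<close>.
\<close>

type_synonym ('a, 'r) laurent = "(int ^ 'r) \<Rightarrow>\<^sub>0 'a"

definition laurent_monom :: "int ^ 'r \<Rightarrow> ('a::field, 'r::finite) laurent" where
  "laurent_monom w = Poly_Mapping.single w 1"

definition laurent_scale :: "'a::field \<Rightarrow> ('a, 'r::finite) laurent \<Rightarrow> ('a, 'r) laurent" where
  "laurent_scale c f = Poly_Mapping.single 0 c * f"

interpretation laurent: vector_space "laurent_scale :: 'a::field \<Rightarrow> ('a, 'r::finite) laurent \<Rightarrow> _"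
  by unfold_locales
     (simp_all add: laurent_scale_def algebra_simps single_add mult_single flip: mult.assoc)

definition laurent_space :: "(int ^ 'r) set \<Rightarrow> ('a::field, 'r::finite) laurent set" where
  "laurent_space W = laurent.span (laurent_monom ` W)"

definition laurent_eval :: "('a::field, 'r::finite) laurent \<Rightarrow> 'a ^ 'r \<Rightarrow> 'a" where
  "laurent_eval f P =
     (\<Sum>w\<in>Poly_Mapping.keys f. Poly_Mapping.lookup f w * (\<Prod>i\<in>UNIV. (P $ i) powi (w $ i)))"

definition real_vec :: "int ^ 'r \<Rightarrow> real ^ 'r::finite" where
  "real_vec w = (\<chi> i. real_of_int (w $ i))"

definition integral_polytope :: "(real ^ 'r::finite) set \<Rightarrow> bool" where
  "integral_polytope S \<longleftrightarrow> (\<exists>V. finite V \<and> S = convex hull (real_vec ` V))"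

definition lattice_points :: "(real ^ 'r::finite) set \<Rightarrow> (int ^ 'r) set" where
  "lattice_points S = {w. real_vec w \<in> S}"

text \<open>
  A word with coordinates indexed by a set \<open>I\<close> is an element of \<open>I \<rightarrow>\<^sub>E UNIV\<close>;
  the zero word is \<open>\<lambda>P\<in>I. 0\<close>.
\<close>

definition hamming_weight :: "'p set \<Rightarrow> ('p \<Rightarrow> 'a::zero) \<Rightarrow> nat" where
  "hamming_weight I c = card {P \<in> I. c P \<noteq> 0}"

text \<open>
  The value for the zero code is unspecified (\<^term>\<open>Inf {} :: nat\<close>). The toric code of a
  polytope is non-zero as soon as the polytope contains a lattice point.
\<close>

definition min_distance :: "'p set \<Rightarrow> ('p \<Rightarrow> 'a::zero) set \<Rightarrow> nat" where
  "min_distance I C = Inf (hamming_weight I ` (C - {\<lambda>P\<in>I. 0}))"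

definition torus :: "('a::field ^ 'r::finite) set" where
  "torus = {P. \<forall>i. P $ i \<noteq> 0}"

definition toric_code :: "(real ^ 'r::finite) set \<Rightarrow> ('a::field ^ 'r \<Rightarrow> 'a) set" where
  "toric_code S = (\<lambda>f. \<lambda>P\<in>torus. laurent_eval f P) ` laurent_space (lattice_points S)"

definition decoding_map ::
  "('a::field ^ 'r::finite \<Rightarrow> 'a) \<Rightarrow> ('a, 'r) laurent \<times> ('a, 'r) laurent \<Rightarrow> ('a ^ 'r \<Rightarrow> 'a)" where
  "decoding_map y = (\<lambda>(g, h). \<lambda>P\<in>torus. laurent_eval g P * y P - laurent_eval h P)"

end

theory Submission
  imports Defs
begin

text \<open>
  Off the support of the error, membership in the kernel says that \<open>h = g f\<close>. So \<open>g f - h\<close>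
  evaluates to a word of the code of the Minkowski sum of weight at most \<open>t\<close>, which is smaller
  than its minimum distance; hence \<open>h = g f\<close> on the whole torus, and the kernel condition reduces
  to \<open>g e = 0\<close>.
\<close>

text \<open>Exponents outside the support contribute zero. Cancellation can shrink the support of
  \<open>f + g\<close>, so additivity needs a common index set for all three sums.\<close>

lemma laurent_eval_superset:
  assumes "finite A" "Poly_Mapping.keys f \<subseteq> A"
  shows "laurent_eval f P =
    (\<Sum>w\<in>A. Poly_Mapping.lookup f w * (\<Prod>i\<in>UNIV. (P $ i) powi (w $ i)))"
  unfolding laurent_eval_def
  by (rule sum.mono_neutral_left) (use assms in \<open>auto simp: in_keys_iff\<close>)

lemma laurent_eval_add: "laurent_eval (f + g) P = laurent_eval f P + laurent_eval g P"
proof -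
  let ?A = "Poly_Mapping.keys f \<union> Poly_Mapping.keys g"
  have "finite ?A" "Poly_Mapping.keys (f + g) \<subseteq> ?A"
    using Poly_Mapping.keys_add[of f g] by auto
  then show ?thesis
    by (simp add: laurent_eval_superset[of ?A] lookup_add sum.distrib distrib_right)
qed

lemma laurent_eval_0 [simp]: "laurent_eval 0 P = 0"
  by (simp add: laurent_eval_def)

lemma laurent_eval_sum: "laurent_eval (\<Sum>a\<in>A. F a) P = (\<Sum>a\<in>A. laurent_eval (F a) P)"
  by (induction A rule: infinite_finite_induct) (auto simp: laurent_eval_add)

lemma laurent_eval_diff: "laurent_eval (f - g) P = laurent_eval f P - laurent_eval g P"
  using laurent_eval_add[of "f - g" g P] by simp

lemma laurent_eval_single:
  "laurent_eval (Poly_Mapping.single w c) P = c * (\<Prod>i\<in>UNIV. (P $ i) powi (w $ i))"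
  by (subst laurent_eval_superset[of "{w}"]) auto

lemma sum_single_keys:
  "(\<Sum>w\<in>Poly_Mapping.keys f. Poly_Mapping.single w (Poly_Mapping.lookup f w)) = f"
  by (rule poly_mapping_eqI) (auto simp: lookup_sum lookup_single when_def in_keys_iff)

text \<open>Exponents may be negative, and \<open>x powi (m + n) = x powi m * x powi n\<close> can
  fail at \<open>x = 0\<close>; on the torus every coordinate is non-zero.\<close>

lemma laurent_eval_single_mult:
  assumes "P \<in> torus"
  shows "laurent_eval (Poly_Mapping.single v c * Poly_Mapping.single w d) P =
    laurent_eval (Poly_Mapping.single v c) P * laurent_eval (Poly_Mapping.single w d) P"
  using assms
  by (simp add: mult_single laurent_eval_single torus_def power_int_add prod.distrib)

text \<open>Both factors are expanded into monomial terms, and bilinearity of the convolution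
  reduces the claim to single terms.\<close>

lemma laurent_eval_mult:
  assumes "P \<in> torus"
  shows "laurent_eval (f * g) P = laurent_eval f P * laurent_eval g P"
proof -
  let ?t = "\<lambda>f w. Poly_Mapping.single w (Poly_Mapping.lookup f w)"
  have "laurent_eval ((\<Sum>v\<in>Poly_Mapping.keys f. ?t f v) * (\<Sum>w\<in>Poly_Mapping.keys g. ?t g w)) P =
    laurent_eval (\<Sum>v\<in>Poly_Mapping.keys f. ?t f v) P *
    laurent_eval (\<Sum>w\<in>Poly_Mapping.keys g. ?t g w) P"
    by (simp only: sum_product laurent_eval_sum laurent_eval_single_mult[OF assms])
  then show ?thesis
    by (simp only: sum_single_keys)
qed

lemma laurent_scale_monom: "laurent_scale c (laurent_monom w) = Poly_Mapping.single w c"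
  by (simp add: laurent_scale_def laurent_monom_def mult_single)

text \<open>The monomials form the standard basis, so membership in their span becomes an inclusion
  of exponent sets.\<close>

lemma laurent_space_iff_keys: "f \<in> laurent_space W \<longleftrightarrow> Poly_Mapping.keys f \<subseteq> W"
proof
  assume "f \<in> laurent_space W"
  then show "Poly_Mapping.keys f \<subseteq> W"
    unfolding laurent_space_def
  proof (induction rule: laurent.span_induct_alt)
    case base
    then show ?case by simp
  next
    case (step c x y)
    then obtain w where "w \<in> W" "x = laurent_monom w"
      by auto
    then show ?case
      using step Poly_Mapping.keys_add[of "laurent_scale c x" y]
      by (auto simp: laurent_scale_monom split: if_splits)
  qed
next
  assume "Poly_Mapping.keys f \<subseteq> W"
  then have "(\<Sum>w\<in>Poly_Mapping.keys f. laurent_scale (Poly_Mapping.lookup f w) (laurent_monom w))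
      \<in> laurent_space W"
    unfolding laurent_space_def
    by (intro laurent.span_sum laurent.span_scale laurent.span_base) auto
  then show "f \<in> laurent_space W"
    by (simp only: laurent_scale_monom sum_single_keys)
qed

lemma mult_in_laurent_space:
  assumes "f \<in> laurent_space V" "g \<in> laurent_space W"
  shows "f * g \<in> laurent_space (V + W)"
  using assms Poly_Mapping.keys_mult[of f g]
  by (fastforce simp: laurent_space_iff_keys set_plus_def)

text \<open>This places \<open>g * f - h\<close>, whose exponents lie in \<open>U + U'\<close>, in
  the space defining the code of \<open>S + S'\<close>. The inclusion can be strict: a lattice point
  of a Minkowski sum need not split into lattice points.\<close>

lemma lattice_points_add:
  "lattice_points S + lattice_points S' \<subseteq> lattice_points (S + S')"
proof
  fix w assume "w \<in> lattice_points S + lattice_points S'"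
  then obtain u v where "w = u + v" "real_vec u \<in> S" "real_vec v \<in> S'"
    by (auto simp: lattice_points_def set_plus_def)
  moreover have "real_vec (u + v) = real_vec u + real_vec v"
    by (simp add: real_vec_def vec_eq_iff)
  ultimately show "w \<in> lattice_points (S + S')"
    by (auto simp: lattice_points_def)
qed

text \<open>The non-zero word \<open>c\<close> makes the set of weights non-empty, so
  \<open>Inf\<close> is a true minimum here and not its unspecified value on the empty set.\<close>

lemma min_distance_le:
  assumes "c \<in> C" "c \<noteq> (\<lambda>P\<in>I. 0)"
  shows "min_distance I C \<le> hamming_weight I c"
  unfolding min_distance_def by (rule wellorder_Inf_le1) (use assms in auto)

theorem lemma6p1:
  fixes S S' :: "(real ^ 'r::finite) set"
    and U U' :: "(int ^ 'r) set"
    and n t :: nat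
    and f g h :: "('a::{field,finite}, 'r) laurent"
    and y e :: "'a ^ 'r \<Rightarrow> 'a"
    and T :: "('a ^ 'r) set"
  assumes "integral_polytope S" and "integral_polytope S'"
    and "U = lattice_points S" and "U' = lattice_points S'"
    and "n = card (torus :: ('a ^ 'r) set)"
    and "card U' > t"
    and "min_distance torus (toric_code (S + S') :: ('a ^ 'r \<Rightarrow> 'a) set) > t"
    and "int (min_distance torus (toric_code S' :: ('a ^ 'r \<Rightarrow> 'a) set))
           > int n - int (min_distance torus (toric_code S :: ('a ^ 'r \<Rightarrow> 'a) set))"
    and "f \<in> laurent_space U"
    and "T = {P \<in> torus. e P \<noteq> 0}" and "card T \<le> t"
    and "\<And>P. P \<in> torus \<Longrightarrow> y P = laurent_eval f P + e P"
    and "(g, h) \<in> laurent_space U' \<times> laurent_space (U + U')"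
    and "decoding_map y (g, h) = (\<lambda>P\<in>torus. 0)"
  shows "(\<forall>P\<in>T. laurent_eval g P = 0) \<and>
         (\<forall>P\<in>torus. laurent_eval h P = laurent_eval g P * laurent_eval f P)"
proof -
  let ?F = "g * f - h"
  let ?c = "\<lambda>P\<in>torus. laurent_eval ?F P"
  have ker: "laurent_eval g P * (laurent_eval f P + e P) = laurent_eval h P" if "P \<in> torus" for P
    using fun_cong[OF assms(14), of P] assms(12)[OF that] that by (simp add: decoding_map_def)
  have eval: "laurent_eval ?F P = laurent_eval g P * laurent_eval f P - laurent_eval h P"
    if "P \<in> torus" for P
    using that by (simp add: laurent_eval_diff laurent_eval_mult)
  have "g * f \<in> laurent_space (U + U')"
    using mult_in_laurent_space[of g U' f U] assms(9,13) by (simp add: add.commute)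
  then have "?F \<in> laurent_space (U + U')"
    using assms(13) unfolding laurent_space_def by (auto intro: laurent.span_diff)
  then have "?F \<in> laurent_space (lattice_points (S + S'))"
    using lattice_points_add[of S S'] assms(3,4) by (auto simp: laurent_space_iff_keys)
  then have in_code: "?c \<in> toric_code (S + S')"
    unfolding toric_code_def by blast
  have "{P \<in> torus. ?c P \<noteq> 0} \<subseteq> T"
    using ker by (force simp: assms(10) eval)
  then have "hamming_weight torus ?c \<le> t"
    \<comment> \<open>\<open>T\<close> is finite because the field, and hence
      \<open>'a ^ 'r\<close>, is a finite type.\<close>
    unfolding hamming_weight_def using assms(11) card_mono[of T] by (meson finite le_trans)
  \<comment> \<open>Otherwise the minimum distance would be at most the weight of \<open>?c\<close>,
    hence at most \<open>t\<close>.\<close>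
  then have c0: "?c = (\<lambda>P\<in>torus. 0)"
    using min_distance_le[OF in_code, of torus] assms(7) by linarith
  have gf: "laurent_eval h P = laurent_eval g P * laurent_eval f P" if "P \<in> torus" for P
    using fun_cong[OF c0, of P] eval[OF that] that by simp
  \<comment> \<open>Comparing \<open>ker\<close> with \<open>gf\<close> leaves a vanishing product
    of \<open>laurent_eval g P\<close> and \<open>e P\<close>, and \<open>e P\<close> is non-zero on
    \<open>T\<close>.\<close>
  have "laurent_eval g P = 0" if "P \<in> T" for P
    using ker[of P] gf[of P] that by (auto simp: assms(10) distrib_left)
  with gf show ?thesis by blast
qed

end
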